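(* Let $m\ge1$ be an integer, let $h_1,\dots,h_n:(A,\kappa_1)\to(B,\lambda_1)$ and $k_1,\dots,k_n:(A',\kappa_1')\to(B',\lambda_1')$ be digitally continuous maps, and let $\omega_1:(B,\lambda_1)\to(B',\lambda_1')$ and $\omega_2:(A',\kappa_1')\to(A,\kappa_1)$ be digital homotopy equivalences such that $$\omega_1\circ h_i\circ\omega_2\simeq_{\kappa_1',\lambda_1'}k_i\quad\text{for each } i\in\{1,\dots,n\}.$$ Then $\mathrm{D}_m(h_1,\dots,h_n)=\mathrm{D}_m(k_1,\dots,k_n)$.
   Context: Digital images: a digital image is a pair $(A,\kappa)$ with $A\subseteq\mathbb{Z}^r$ and $\kappa$ an adjacency relation on $A$; the basic ones are $c_p$ ($1\le p\le r$), where distinct $a,a'\in\mathbb{Z}^r$ are $c_p$-adjacent iff there are at most $p$ indices $i$ with $|a_i-a'_i|=1$ and $a_i=a'_i$ for all other $i$. Subsets carry the restricted adjacency. $a\leftrightarrow_\kappa a'$ means adjacent. A map $h:(A,\kappa)\to(A',\lambda)$ is digitally $(\kappa,\lambda)$-continuous if $a\leftrightarrow_\kappa a'$ implies that $h(a)=h(a')$ or $h(a)\leftrightarrow_\lambda h(a')$. On a product of digital images, the adjacency $\mathrm{NP}$ (normal/strong product) declares two distinct points adjacent iff in each coordinate they are equal or adjacent. Homotopy: $[0,z]_{\mathbb{Z}}=\{0,1,\dots,z\}$ carries the adjacency $2=c_1$ of $\mathbb{Z}$. Digitally continuous $h,k:(A,\kappa)\to(A',\lambda)$ are digitally homotopic,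 $h\simeq_{\kappa,\lambda}k$, if for some $z$ there is a digitally continuous $K:(A\times[0,z]_{\mathbb{Z}},\mathrm{NP}(\kappa,2))\to(A',\lambda)$ with $K(a,0)=h(a)$, $K(a,z)=k(a)$ for all $a$ (in particular $K(\cdot,t)$ and $K(a,\cdot)$ are digitally continuous for fixed $t$, $a$). A digitally continuous map $h:A\to A'$ is a digital homotopy equivalence if there is a digitally continuous $h':A'\to A$ with $h\circ h'$ and $h'\circ h$ digitally homotopic to the identity maps. For $m>0$, an $m$-dimensional digital complex is a finite digital image $(P,\delta)$ with $P\subseteq\mathbb{Z}^m$. Digital higher $m$-homotopic distance $\mathrm{D}_m(h_1,\dots,h_n)$ of digitally continuous $h_1,\dots,h_n:(A,\kappa_1)\to(A',\lambda_1)$: the least integer $q\ge0$ such that $A=X_0\cup\dots\cup X_q$ where, for each $j$, every $m$-dimensional digital complex $(P,\delta)$ and every $(\delta,\kappa_1)$-continuous $\phi:P\to X_j$ satisfy $h_1\circ\phi\simeq_{\delta,\lambda_1}\cdots\simeq_{\delta,\lambda_1}h_n\circ\phi$ ($\infty$ if there is no such $q$). *)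

theory Defs
  imports Main "HOL-Library.Extended_Nat" "HOL-Library.FuncSet"
begin

text \<open>
  Points of \<open>\<int>\<^sup>r\<close> are integer lists of length \<open>r\<close>.  An adjacency is a binary predicate of which
  only the values on the carrier matter; hence a subset of an image carries the restricted
  adjacency without any change of the predicate.
\<close>

definition lattice_points :: "nat \<Rightarrow> int list set" where
  "lattice_points r = {x. length x = r}"

definition digital_image :: "nat \<Rightarrow> int list set \<Rightarrow> (int list \<Rightarrow> int list \<Rightarrow> bool) \<Rightarrow> bool" where
  "digital_image r A \<kappa> \<longleftrightarrow> A \<subseteq> lattice_points r \<and> irreflp_on A \<kappa> \<and> symp_on A \<kappa>"

definition digital_complex :: "nat \<Rightarrow> int list set \<Rightarrow> (int list \<Rightarrow> int list \<Rightarrow> bool) \<Rightarrow> bool" where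
  "digital_complex m P \<delta> \<longleftrightarrow> 0 < m \<and> finite P \<and> digital_image m P \<delta>"

definition digitally_continuous ::
  "'a set \<Rightarrow> ('a \<Rightarrow> 'a \<Rightarrow> bool) \<Rightarrow> 'b set \<Rightarrow> ('b \<Rightarrow> 'b \<Rightarrow> bool) \<Rightarrow> ('a \<Rightarrow> 'b) \<Rightarrow> bool" where
  "digitally_continuous A \<kappa> A' \<mu> h \<longleftrightarrow>
     h \<in> A \<rightarrow> A' \<and> (\<forall>a\<in>A. \<forall>a'\<in>A. \<kappa> a a' \<longrightarrow> h a = h a' \<or> \<mu> (h a) (h a'))"

definition np_adj ::
  "('a \<Rightarrow> 'a \<Rightarrow> bool) \<Rightarrow> ('b \<Rightarrow> 'b \<Rightarrow> bool) \<Rightarrow> 'a \<times> 'b \<Rightarrow> 'a \<times> 'b \<Rightarrow> bool" where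
  "np_adj \<kappa> \<nu> p q \<longleftrightarrow>
     p \<noteq> q \<and> (fst p = fst q \<or> \<kappa> (fst p) (fst q)) \<and> (snd p = snd q \<or> \<nu> (snd p) (snd q))"

text \<open>The adjacency \<open>2 = c\<^sub>1\<close> of \<open>\<int>\<close>; here \<open>\<int>\<^sup>1\<close> is identified with \<^typ>\<open>int\<close>.\<close>

definition int_adj :: "int \<Rightarrow> int \<Rightarrow> bool" where
  "int_adj s t \<longleftrightarrow> \<bar>s - t\<bar> = 1"

definition digitally_homotopic ::
  "'a set \<Rightarrow> ('a \<Rightarrow> 'a \<Rightarrow> bool) \<Rightarrow> 'b set \<Rightarrow> ('b \<Rightarrow> 'b \<Rightarrow> bool) \<Rightarrow> ('a \<Rightarrow> 'b) \<Rightarrow> ('a \<Rightarrow> 'b) \<Rightarrow> bool" where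
  "digitally_homotopic A \<kappa> A' \<mu> h k \<longleftrightarrow>
     digitally_continuous A \<kappa> A' \<mu> h \<and> digitally_continuous A \<kappa> A' \<mu> k \<and>
     (\<exists>z::nat. \<exists>K :: 'a \<times> int \<Rightarrow> 'b.
        digitally_continuous (A \<times> {0..int z}) (np_adj \<kappa> int_adj) A' \<mu> K \<and>
        (\<forall>a\<in>A. K (a, 0) = h a \<and> K (a, int z) = k a))"

definition digital_homotopy_equivalence ::
  "'a set \<Rightarrow> ('a \<Rightarrow> 'a \<Rightarrow> bool) \<Rightarrow> 'b set \<Rightarrow> ('b \<Rightarrow> 'b \<Rightarrow> bool) \<Rightarrow> ('a \<Rightarrow> 'b) \<Rightarrow> bool" where
  "digital_homotopy_equivalence A \<kappa> A' \<mu> h \<longleftrightarrow>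
     digitally_continuous A \<kappa> A' \<mu> h \<and>
     (\<exists>h'. digitally_continuous A' \<mu> A \<kappa> h' \<and>
        digitally_homotopic A' \<mu> A' \<mu> (h \<circ> h') id \<and>
        digitally_homotopic A \<kappa> A \<kappa> (h' \<circ> h) id)"

text \<open>
  \<open>homotopic_on_complexes m X \<kappa> A' \<mu> n h\<close>: the condition imposed on each member \<open>X\<close> of the
  cover.  The family \<open>h\<^sub>1, \<dots>, h\<^sub>n\<close> is a function on \<^typ>\<open>nat\<close> of which only the indices
  \<open>1, \<dots>, n\<close> are used.
\<close>

definition homotopic_on_complexes ::
  "nat \<Rightarrow> int list set \<Rightarrow> (int list \<Rightarrow> int list \<Rightarrow> bool) \<Rightarrow>
   int list set \<Rightarrow> (int list \<Rightarrow> int list \<Rightarrow> bool) \<Rightarrow> nat \<Rightarrow> (nat \<Rightarrow> int list \<Rightarrow> int list) \<Rightarrow> bool" where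
  "homotopic_on_complexes m X \<kappa> A' \<mu> n h \<longleftrightarrow>
     (\<forall>P \<delta> \<phi>. digital_complex m P \<delta> \<longrightarrow> digitally_continuous P \<delta> X \<kappa> \<phi> \<longrightarrow>
        (\<forall>i\<in>{1..<n}. digitally_homotopic P \<delta> A' \<mu> (h i \<circ> \<phi>) (h (Suc i) \<circ> \<phi>)))"

definition has_homotopic_cover ::
  "nat \<Rightarrow> int list set \<Rightarrow> (int list \<Rightarrow> int list \<Rightarrow> bool) \<Rightarrow>
   int list set \<Rightarrow> (int list \<Rightarrow> int list \<Rightarrow> bool) \<Rightarrow> nat \<Rightarrow> (nat \<Rightarrow> int list \<Rightarrow> int list) \<Rightarrow>
   nat \<Rightarrow> bool" where
  "has_homotopic_cover m A \<kappa> A' \<mu> n h q \<longleftrightarrow>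
     (\<exists>X :: nat \<Rightarrow> int list set.
        A = (\<Union>j\<in>{0..q}. X j) \<and> (\<forall>j\<in>{0..q}. homotopic_on_complexes m (X j) \<kappa> A' \<mu> n h))"

definition digital_homotopic_distance ::
  "nat \<Rightarrow> int list set \<Rightarrow> (int list \<Rightarrow> int list \<Rightarrow> bool) \<Rightarrow>
   int list set \<Rightarrow> (int list \<Rightarrow> int list \<Rightarrow> bool) \<Rightarrow> nat \<Rightarrow> (nat \<Rightarrow> int list \<Rightarrow> int list) \<Rightarrow> enat" where
  "digital_homotopic_distance m A \<kappa> A' \<mu> n h =
     (if \<exists>q. has_homotopic_cover m A \<kappa> A' \<mu> n h q
      then enat (LEAST q. has_homotopic_cover m A \<kappa> A' \<mu> n h q) else \<infinity>)"

end

theory Submission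
  imports Defs
begin

text \<open>
  Only continuity of the two outer maps is needed to transport a cover: if \<open>f \<circ> h\<^sub>i \<circ> g \<simeq> k\<^sub>i\<close>
  for all \<open>i\<close>, then the \<open>g\<close>-preimages of a cover that is good for \<open>h\<close> form a cover that is good
  for \<open>k\<close>, because \<open>k\<^sub>i \<circ> \<phi> \<simeq> f \<circ> h\<^sub>i \<circ> (g \<circ> \<phi>)\<close>.  With homotopy inverses the hypothesis can be
  turned around, \<open>\<omega>\<^sub>1' \<circ> k\<^sub>i \<circ> \<omega>\<^sub>2' \<simeq> \<omega>\<^sub>1' \<circ> \<omega>\<^sub>1 \<circ> h\<^sub>i \<circ> \<omega>\<^sub>2 \<circ> \<omega>\<^sub>2' \<simeq> h\<^sub>i\<close>, so the two families have
  covers of the same sizes.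
\<close>

lemma digitally_continuous_compose:
  assumes "digitally_continuous A \<kappa> B \<mu> f" and "digitally_continuous B \<mu> C \<nu> g"
  shows "digitally_continuous A \<kappa> C \<nu> (g \<circ> f)"
  using assms unfolding digitally_continuous_def Pi_iff comp_def by metis

text \<open>Subsets carry the same adjacency predicate, so the codomain enters only through
  membership. This allows enlarging it from a preimage to \<open>A'\<close> and shrinking it from
  \<open>A\<close> to a cover member.\<close>

lemma digitally_continuous_codomain:
  assumes "digitally_continuous A \<kappa> B \<mu> f" and "f \<in> A \<rightarrow> C"
  shows "digitally_continuous A \<kappa> C \<mu> f"
  using assms unfolding digitally_continuous_def by blast

lemma digitally_homotopic_sym:
  assumes "digitally_homotopic A \<kappa> B \<mu> f g"
  shows "digitally_homotopic A \<kappa> B \<mu> g f"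
proof -
  obtain z :: nat and K where
    K: "digitally_continuous (A \<times> {0..int z}) (np_adj \<kappa> int_adj) B \<mu> K" and
    ends: "\<forall>a\<in>A. K (a, 0) = f a \<and> K (a, int z) = g a"
    using assms unfolding digitally_homotopic_def by blast
  \<comment> \<open>Reflecting time by t \<mapsto> z - t preserves adjacency of times, so the
    homotopy can be run backwards.\<close>
  have "digitally_continuous (A \<times> {0..int z}) (np_adj \<kappa> int_adj) (A \<times> {0..int z})
      (np_adj \<kappa> int_adj) (\<lambda>p. (fst p, int z - snd p))"
    by (auto simp: digitally_continuous_def np_adj_def int_adj_def)
  from digitally_continuous_compose[OF this K] show ?thesis
    using assms ends unfolding digitally_homotopic_def
    by (intro conjI exI[of _ z] exI[of _ "K \<circ> (\<lambda>p. (fst p, int z - snd p))"]) auto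
qed

text \<open>The two homotopies are run one after the other, the second delayed by the length
  \<open>z\<close> of the first; both equal \<open>g\<close> at the junction.\<close>

lemma digitally_homotopic_trans:
  assumes "digitally_homotopic A \<kappa> B \<mu> f g" and "digitally_homotopic A \<kappa> B \<mu> g h"
  shows "digitally_homotopic A \<kappa> B \<mu> f h"
proof -
  obtain z :: nat and K where
    K: "digitally_continuous (A \<times> {0..int z}) (np_adj \<kappa> int_adj) B \<mu> K" and
    K_ends: "\<forall>a\<in>A. K (a, 0) = f a \<and> K (a, int z) = g a"
    using assms(1) unfolding digitally_homotopic_def by blast
  obtain w :: nat and L where
    L: "digitally_continuous (A \<times> {0..int w}) (np_adj \<kappa> int_adj) B \<mu> L" and
    L_ends: "\<forall>a\<in>A. L (a, 0) = g a \<and> L (a, int w) = h a"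
    using assms(2) unfolding digitally_homotopic_def by blast
  define M where "M = (\<lambda>(a, t). if t \<le> int z then K (a, t) else L (a, t - int z))"
  have M_K: "M (a, t) = K (a, t)" if "t \<le> int z" for a t
    using that by (simp add: M_def)
  \<comment> \<open>At t = z the definition of \<open>M\<close> selects \<open>K\<close>, but
    \<open>K (a, z) = g a = L (a, 0)\<close>. Hence both descriptions of \<open>M\<close> hold
    there, and the two cases below may share the time \<open>z\<close>.\<close>
  have M_L: "M (a, t) = L (a, t - int z)" if "a \<in> A" "int z \<le> t" for a t
    using that K_ends L_ends by (cases "t = int z") (auto simp: M_def)
  have "digitally_continuous (A \<times> {0..int (z + w)}) (np_adj \<kappa> int_adj) B \<mu> M"
    unfolding digitally_continuous_def
  proof (intro conjI ballI impI)
    have "M (a, t) \<in> B" if "a \<in> A" "t \<in> {0..int (z + w)}" for a t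
      using that K L by (cases "t \<le> int z") (auto simp: M_def digitally_continuous_def Pi_iff)
    then show "M \<in> A \<times> {0..int (z + w)} \<rightarrow> B"
      by auto
  next
    fix p q
    assume p: "p \<in> A \<times> {0..int (z + w)}" and q: "q \<in> A \<times> {0..int (z + w)}"
      and adj: "np_adj \<kappa> int_adj p q"
    obtain a t b u where [simp]: "p = (a, t)" "q = (b, u)"
      by (cases p, cases q)
    \<comment> \<open>adjacent times differ by at most 1, hence never lie strictly on both sides of \<open>z\<close>\<close>
    consider "t \<le> int z" "u \<le> int z" | "int z \<le> t" "int z \<le> u"
      using adj by (fastforce simp: np_adj_def int_adj_def)
    then show "M p = M q \<or> \<mu> (M p) (M q)"
    proof cases
      case 1
      with p q adj K have "K p = K q \<or> \<mu> (K p) (K q)"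
        unfolding digitally_continuous_def by auto
      with 1 show ?thesis
        by (simp add: M_K)
    next
      case 2
      \<comment> \<open>Shifting both times back by \<open>z\<close> keeps the points adjacent and
        puts them in the domain of \<open>L\<close>.\<close>
      let ?p = "(a, t - int z)" and ?q = "(b, u - int z)"
      have "?p \<in> A \<times> {0..int w}" "?q \<in> A \<times> {0..int w}" "np_adj \<kappa> int_adj ?p ?q"
        using p q adj 2 by (auto simp: np_adj_def int_adj_def)
      with L have "L ?p = L ?q \<or> \<mu> (L ?p) (L ?q)"
        unfolding digitally_continuous_def by blast
      with 2 p q show ?thesis
        by (simp add: M_L)
    qed
  qed
  moreover have "M (a, 0) = f a \<and> M (a, int (z + w)) = h a" if "a \<in> A" for a
    using that K_ends L_ends by (simp add: M_K M_L)
  ultimately show ?thesis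
    using assms unfolding digitally_homotopic_def by blast
qed

text \<open>The homotopy is precomposed with \<phi> \<times> id. This product map is continuous for
  the strong product: if \<phi> merges adjacent points, their images agree in the first coordinate,
  which \<open>np_adj\<close> and continuity both tolerate.\<close>

lemma digitally_homotopic_compose_right:
  assumes "digitally_homotopic A \<kappa> B \<mu> f g" and "digitally_continuous P \<delta> A \<kappa> \<phi>"
  shows "digitally_homotopic P \<delta> B \<mu> (f \<circ> \<phi>) (g \<circ> \<phi>)"
proof -
  obtain z :: nat and K where
    K: "digitally_continuous (A \<times> {0..int z}) (np_adj \<kappa> int_adj) B \<mu> K" and
    ends: "\<forall>a\<in>A. K (a, 0) = f a \<and> K (a, int z) = g a"
    using assms(1) unfolding digitally_homotopic_def by blast
  have "digitally_continuous (P \<times> {0..int z}) (np_adj \<delta> int_adj) (A \<times> {0..int z})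
      (np_adj \<kappa> int_adj) (map_prod \<phi> id)"
    using assms(2) by (auto simp: digitally_continuous_def np_adj_def)
  note K' = digitally_continuous_compose[OF this K]
  have "\<forall>a\<in>P. \<phi> a \<in> A"
    using assms(2) by (auto simp: digitally_continuous_def)
  then have "\<forall>a\<in>P. (K \<circ> map_prod \<phi> id) (a, 0) = (f \<circ> \<phi>) a \<and>
      (K \<circ> map_prod \<phi> id) (a, int z) = (g \<circ> \<phi>) a"
    using ends by simp
  then show ?thesis
    using assms K' unfolding digitally_homotopic_def
    by (blast intro: digitally_continuous_compose)
qed

lemma digitally_homotopic_compose_left:
  assumes "digitally_homotopic A \<kappa> B \<mu> f g" and "digitally_continuous B \<mu> C \<nu> \<psi>"
  shows "digitally_homotopic A \<kappa> C \<nu> (\<psi> \<circ> f) (\<psi> \<circ> g)"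
proof -
  obtain z :: nat and K where
    K: "digitally_continuous (A \<times> {0..int z}) (np_adj \<kappa> int_adj) B \<mu> K" and
    ends: "\<forall>a\<in>A. K (a, 0) = f a \<and> K (a, int z) = g a"
    using assms(1) unfolding digitally_homotopic_def by blast
  have "\<forall>a\<in>A. (\<psi> \<circ> K) (a, 0) = (\<psi> \<circ> f) a \<and> (\<psi> \<circ> K) (a, int z) = (\<psi> \<circ> g) a"
    using ends by simp
  then show ?thesis
    using assms digitally_continuous_compose[OF K assms(2)] unfolding digitally_homotopic_def
    by (blast intro: digitally_continuous_compose)
qed

lemma homotopic_on_complexes_transfer:
  assumes "homotopic_on_complexes m X \<kappa> B \<mu> n h"
    and f: "digitally_continuous B \<mu> B' \<mu>' f" and g: "digitally_continuous A' \<kappa>' A \<kappa> g"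
    and hk: "\<And>i. i \<in> {1..n} \<Longrightarrow> digitally_homotopic A' \<kappa>' B' \<mu>' (f \<circ> h i \<circ> g) (k i)"
  shows "homotopic_on_complexes m {a \<in> A'. g a \<in> X} \<kappa>' B' \<mu>' n k"
  unfolding homotopic_on_complexes_def
proof (intro allI impI ballI)
  fix P \<delta> \<phi> i
  assume P: "digital_complex m P \<delta>"
    and \<phi>: "digitally_continuous P \<delta> {a \<in> A'. g a \<in> X} \<kappa>' \<phi>" and i: "i \<in> {1..<n}"
  have \<phi>A': "digitally_continuous P \<delta> A' \<kappa>' \<phi>"
    using \<phi> by (rule digitally_continuous_codomain) (use \<phi> in \<open>auto simp: digitally_continuous_def\<close>)
  \<comment> \<open>Points of the preimage are sent into \<open>X\<close> by \<open>g\<close>, so g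
    \<circ> \<phi> is itself a test map for the cover member \<open>X\<close>.\<close>
  have "digitally_continuous P \<delta> X \<kappa> (g \<circ> \<phi>)"
    using digitally_continuous_compose[OF \<phi>A' g]
    by (rule digitally_continuous_codomain) (use \<phi> in \<open>auto simp: digitally_continuous_def\<close>)
  with assms(1) P i have "digitally_homotopic P \<delta> B \<mu> (h i \<circ> (g \<circ> \<phi>)) (h (Suc i) \<circ> (g \<circ> \<phi>))"
    unfolding homotopic_on_complexes_def by blast
  from digitally_homotopic_compose_left[OF this f]
  have mid: "digitally_homotopic P \<delta> B' \<mu>' (f \<circ> h i \<circ> g \<circ> \<phi>) (f \<circ> h (Suc i) \<circ> g \<circ> \<phi>)"
    by (simp add: comp_assoc)
  have "digitally_homotopic P \<delta> B' \<mu>' (f \<circ> h j \<circ> g \<circ> \<phi>) (k j \<circ> \<phi>)" if "j \<in> {1..n}" for j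
    using digitally_homotopic_compose_right[OF hk[OF that] \<phi>A'] .
  \<comment> \<open>Since \<open>i < n\<close>, both \<open>i\<close> and \<open>Suc i\<close> lie
    in \<open>{1..n}\<close>. The two outer links, one of them reversed, join with
    \<open>mid\<close> into a chain of three homotopies.\<close>
  from this[of i] this[of "Suc i"] mid i
  show "digitally_homotopic P \<delta> B' \<mu>' (k i \<circ> \<phi>) (k (Suc i) \<circ> \<phi>)"
    by (auto intro: digitally_homotopic_trans digitally_homotopic_sym)
qed

text \<open>Preimages are taken index by index, so the bound \<open>q\<close> is kept; this is what
  makes the distances comparable.\<close>

lemma has_homotopic_cover_transfer:
  assumes "has_homotopic_cover m A \<kappa> B \<mu> n h q"
    and "digitally_continuous B \<mu> B' \<mu>' f" and g: "digitally_continuous A' \<kappa>' A \<kappa> g"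
    and "\<And>i. i \<in> {1..n} \<Longrightarrow> digitally_homotopic A' \<kappa>' B' \<mu>' (f \<circ> h i \<circ> g) (k i)"
  shows "has_homotopic_cover m A' \<kappa>' B' \<mu>' n k q"
proof -
  obtain X where X: "A = (\<Union>j\<in>{0..q}. X j)"
    and good: "\<And>j. j \<in> {0..q} \<Longrightarrow> homotopic_on_complexes m (X j) \<kappa> B \<mu> n h"
    using assms(1) unfolding has_homotopic_cover_def by blast
  have "g \<in> A' \<rightarrow> A"
    using g by (simp add: digitally_continuous_def)
  then have "A' = (\<Union>j\<in>{0..q}. {a \<in> A'. g a \<in> X j})"
    unfolding X by blast
  moreover have "homotopic_on_complexes m {a \<in> A'. g a \<in> X j} \<kappa>' B' \<mu>' n k" if "j \<in> {0..q}" for j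
    using homotopic_on_complexes_transfer[OF good[OF that] assms(2-4)] .
  ultimately show ?thesis
    unfolding has_homotopic_cover_def by (intro exI[of _ "\<lambda>j. {a \<in> A'. g a \<in> X j}"]) blast
qed

theorem theorem4p11:
  fixes m n r s r' s' :: nat
    and A B A' B' :: "int list set"
    and \<kappa>\<^sub>1 \<mu>\<^sub>1 \<kappa>\<^sub>1' \<mu>\<^sub>1' :: "int list \<Rightarrow> int list \<Rightarrow> bool"
    and h k :: "nat \<Rightarrow> int list \<Rightarrow> int list"
    and \<omega>\<^sub>1 \<omega>\<^sub>2 :: "int list \<Rightarrow> int list"
  assumes "m \<ge> 1"
    and "digital_image r A \<kappa>\<^sub>1" and "digital_image s B \<mu>\<^sub>1"
    and "digital_image r' A' \<kappa>\<^sub>1'" and "digital_image s' B' \<mu>\<^sub>1'"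
    and "\<And>i. i \<in> {1..n} \<Longrightarrow> digitally_continuous A \<kappa>\<^sub>1 B \<mu>\<^sub>1 (h i)"
    and "\<And>i. i \<in> {1..n} \<Longrightarrow> digitally_continuous A' \<kappa>\<^sub>1' B' \<mu>\<^sub>1' (k i)"
    and "digital_homotopy_equivalence B \<mu>\<^sub>1 B' \<mu>\<^sub>1' \<omega>\<^sub>1"
    and "digital_homotopy_equivalence A' \<kappa>\<^sub>1' A \<kappa>\<^sub>1 \<omega>\<^sub>2"
    and "\<And>i. i \<in> {1..n} \<Longrightarrow>
           digitally_homotopic A' \<kappa>\<^sub>1' B' \<mu>\<^sub>1' (\<omega>\<^sub>1 \<circ> h i \<circ> \<omega>\<^sub>2) (k i)"
  shows "digital_homotopic_distance m A \<kappa>\<^sub>1 B \<mu>\<^sub>1 n h = digital_homotopic_distance m A' \<kappa>\<^sub>1' B' \<mu>\<^sub>1' n k"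
proof -
  have \<omega>\<^sub>1: "digitally_continuous B \<mu>\<^sub>1 B' \<mu>\<^sub>1' \<omega>\<^sub>1" and \<omega>\<^sub>2: "digitally_continuous A' \<kappa>\<^sub>1' A \<kappa>\<^sub>1 \<omega>\<^sub>2"
    using assms(8,9) by (simp_all add: digital_homotopy_equivalence_def)
  obtain f where f: "digitally_continuous B' \<mu>\<^sub>1' B \<mu>\<^sub>1 f"
    and f\<omega>\<^sub>1: "digitally_homotopic B \<mu>\<^sub>1 B \<mu>\<^sub>1 (f \<circ> \<omega>\<^sub>1) id"
    using assms(8) unfolding digital_homotopy_equivalence_def by blast
  obtain g where g: "digitally_continuous A \<kappa>\<^sub>1 A' \<kappa>\<^sub>1' g"
    and \<omega>\<^sub>2g: "digitally_homotopic A \<kappa>\<^sub>1 A \<kappa>\<^sub>1 (\<omega>\<^sub>2 \<circ> g) id"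
    using assms(9) unfolding digital_homotopy_equivalence_def by blast
  \<comment> \<open>This is the transfer hypothesis with the roles of \<open>h\<close> and
    \<open>k\<close> exchanged: \<open>f\<close> cancels \<open>\<omega>\<^sub>1\<close> from the
    left and \<open>g\<close> cancels \<open>\<omega>\<^sub>2\<close> from the right, up to
    homotopy.\<close>
  have "digitally_homotopic A \<kappa>\<^sub>1 B \<mu>\<^sub>1 (f \<circ> k i \<circ> g) (h i)" if i: "i \<in> {1..n}" for i
  proof -
    note hi = assms(6)[OF i]
    have 1: "digitally_homotopic A \<kappa>\<^sub>1 B \<mu>\<^sub>1 (f \<circ> (\<omega>\<^sub>1 \<circ> h i \<circ> \<omega>\<^sub>2) \<circ> g) (f \<circ> k i \<circ> g)"
      by (rule digitally_homotopic_compose_right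
          [OF digitally_homotopic_compose_left[OF assms(10)[OF i] f] g])
    \<comment> \<open>The two cancellations are done separately: first on the inside, with f \<circ>
      \<open>\<omega>\<^sub>1\<close> \<circ> \<open>h i\<close> kept as a fixed outer map, then on
      the outside in \<open>3\<close>. Associativity matches the bracketings of the three
      links.\<close>
    have 2: "digitally_homotopic A \<kappa>\<^sub>1 B \<mu>\<^sub>1 (f \<circ> \<omega>\<^sub>1 \<circ> h i \<circ> (\<omega>\<^sub>2 \<circ> g)) (f \<circ> \<omega>\<^sub>1 \<circ> h i \<circ> id)"
      by (rule digitally_homotopic_compose_left[OF \<omega>\<^sub>2g digitally_continuous_compose
            [OF hi digitally_continuous_compose[OF \<omega>\<^sub>1 f]]])
    have 3: "digitally_homotopic A \<kappa>\<^sub>1 B \<mu>\<^sub>1 (f \<circ> \<omega>\<^sub>1 \<circ> h i) (id \<circ> h i)"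
      by (rule digitally_homotopic_compose_right[OF f\<omega>\<^sub>1 hi])
    show ?thesis
      using digitally_homotopic_trans[OF digitally_homotopic_sym[OF 1]]
        digitally_homotopic_trans[OF 2] 3
      by (simp add: comp_assoc)
  qed
  then have "has_homotopic_cover m A \<kappa>\<^sub>1 B \<mu>\<^sub>1 n h q = has_homotopic_cover m A' \<kappa>\<^sub>1' B' \<mu>\<^sub>1' n k q"
    for q
    using has_homotopic_cover_transfer[where h = h and k = k, OF _ \<omega>\<^sub>1 \<omega>\<^sub>2 assms(10)]
      has_homotopic_cover_transfer[where h = k and k = h, OF _ f g]
    by (intro iffI) simp_all
  \<comment> \<open>Equality as predicates in \<open>q\<close> settles the finite and the infinite
    value at once: existence and the least witness agree.\<close>
  then have "has_homotopic_cover m A \<kappa>\<^sub>1 B \<mu>\<^sub>1 n h = has_homotopic_cover m A' \<kappa>\<^sub>1' B' \<mu>\<^sub>1' n k"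
    by blast
  then show ?thesis
    by (simp add: digital_homotopic_distance_def)
qed

end
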